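(* $(\mathbb C_3,B,S)$ is a homogeneous structure.
   Context: $\mathbb C_3$ is the graph whose vertex set is a countable dense subset of the unit circle $S^1$ such that any two distinct points of it lie at a rational angle (in radians, hence never exactly $2\pi/3$), and $E(x,y)$ holds iff both circular arcs with end-points $x,y$ have length strictly larger than $1/3$ of the circumference. $B(x,y,z)$ holds iff $\{x,y,z\}$ is an independent set of three distinct vertices of $\mathbb C_3$ and $y$ lies on the shorter circular arc between $x$ and $z$. $S(x_1,x_2,x_3,x_4)$ holds iff the four points are pairwise distinct and $x_2,x_4$ lie in different connected components of $S^1\setminus\{x_1,x_3\}$. $(\mathbb C_3,B,S)$ is the corresponding $\{E,B,S\}$-structure. A structure is homogeneous if every isomorphism between finite (induced) substructures extends to an automorphism of the whole structure. *)

theory Defs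
  imports "HOL-Analysis.Analysis"
begin

record ('r, 'a) rel_structure =
  universe :: "'a set"
  relation :: "'r \<Rightarrow> 'a list set"

definition induced_substructure ::
  "('r, 'a) rel_structure \<Rightarrow> 'a set \<Rightarrow> ('r, 'a) rel_structure" where
  "induced_substructure M A =
     \<lparr>universe = A, relation = (\<lambda>R. {xs \<in> relation M R. set xs \<subseteq> A})\<rparr>"

definition isomorphism ::
  "('r, 'a) rel_structure \<Rightarrow> ('r, 'b) rel_structure \<Rightarrow> ('a \<Rightarrow> 'b) \<Rightarrow> bool" where
  "isomorphism M N f \<longleftrightarrow>
     bij_betw f (universe M) (universe N) \<and>
     (\<forall>R xs. set xs \<subseteq> universe M \<longrightarrow> (xs \<in> relation M R \<longleftrightarrow> map f xs \<in> relation N R))"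

definition homogeneous :: "('r, 'a) rel_structure \<Rightarrow> bool" where
  "homogeneous M \<longleftrightarrow>
     (\<forall>A A' f. finite A \<and> A \<subseteq> universe M \<and> finite A' \<and> A' \<subseteq> universe M \<and>
        isomorphism (induced_substructure M A) (induced_substructure M A') f \<longrightarrow>
        (\<exists>g. isomorphism M M g \<and> (\<forall>x\<in>A. g x = f x)))"

abbreviation circle :: "complex set" where
  "circle \<equiv> sphere 0 1"

(* Angles are taken modulo 2 * pi: the angle from x to y is rational if some
   representative of it is.  Asking this of the representative in [0, pi], or of
   the one in [0, 2 * pi), for all pairs of points would contradict density, since
   the angles between neighbours in a finite subset going around the circle add up
   to 2 * pi. *)
definition rational_angle :: "complex \<Rightarrow> complex \<Rightarrow> bool" where
  "rational_angle x y \<longleftrightarrow> (\<exists>q\<in>\<rat>. y = x * cis q)"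

definition C3_vertex_set :: "complex set \<Rightarrow> bool" where
  "C3_vertex_set V \<longleftrightarrow>
     V \<subseteq> circle \<and> countable V \<and> circle \<subseteq> closure V \<and>
     (\<forall>x\<in>V. \<forall>y\<in>V. x \<noteq> y \<longrightarrow> rational_angle x y)"

(* For distinct x, y on the circle, the two arcs with end-points x and y are
   ccw_arc x y and ccw_arc y x. *)
definition ccw_length :: "complex \<Rightarrow> complex \<Rightarrow> real" where
  "ccw_length x y = Arg2pi (y / x)"

definition ccw_arc :: "complex \<Rightarrow> complex \<Rightarrow> complex set" where
  "ccw_arc x y = (\<lambda>t. x * cis t) ` {0..ccw_length x y}"

definition C3_edge :: "complex \<Rightarrow> complex \<Rightarrow> bool" where
  "C3_edge x y \<longleftrightarrow> ccw_length x y > 1/3 * (2 * pi) \<and> ccw_length y x > 1/3 * (2 * pi)"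

definition C3_independent :: "complex set \<Rightarrow> bool" where
  "C3_independent A \<longleftrightarrow> (\<forall>u\<in>A. \<forall>v\<in>A. \<not> C3_edge u v)"

(* No arc is the shorter one when x and z are antipodal. *)
definition on_shorter_arc :: "complex \<Rightarrow> complex \<Rightarrow> complex \<Rightarrow> bool" where
  "on_shorter_arc x z y \<longleftrightarrow>
     ccw_length x z < ccw_length z x \<and> y \<in> ccw_arc x z \<or>
     ccw_length z x < ccw_length x z \<and> y \<in> ccw_arc z x"

definition C3_between :: "complex \<Rightarrow> complex \<Rightarrow> complex \<Rightarrow> bool" where
  "C3_between x y z \<longleftrightarrow>
     distinct [x, y, z] \<and> C3_independent {x, y, z} \<and> on_shorter_arc x z y"

definition C3_separation :: "complex \<Rightarrow> complex \<Rightarrow> complex \<Rightarrow> complex \<Rightarrow> bool" where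
  "C3_separation x1 x2 x3 x4 \<longleftrightarrow>
     distinct [x1, x2, x3, x4] \<and>
     (\<exists>C \<in> components (circle - {x1, x3}). \<exists>D \<in> components (circle - {x1, x3}).
        C \<noteq> D \<and> x2 \<in> C \<and> x4 \<in> D)"

datatype C3_symbol = Edge | Between | Separation

fun C3_relation :: "complex set \<Rightarrow> C3_symbol \<Rightarrow> complex list set" where
  "C3_relation V Edge = {[x, y] | x y. {x, y} \<subseteq> V \<and> C3_edge x y}"
| "C3_relation V Between = {[x, y, z] | x y z. {x, y, z} \<subseteq> V \<and> C3_between x y z}"
| "C3_relation V Separation =
     {[x1, x2, x3, x4] | x1 x2 x3 x4. {x1, x2, x3, x4} \<subseteq> V \<and> C3_separation x1 x2 x3 x4}"

definition C3_BS :: "complex set \<Rightarrow> (C3_symbol, complex) rel_structure" where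
  "C3_BS V = \<lparr>universe = V, relation = C3_relation V\<rparr>"

lemma C3_vertex_set_cis_Rats: "C3_vertex_set (cis ` \<rat>)"
proof -
  have dense: "circle \<subseteq> closure (cis ` \<rat>)"
  proof
    fix z :: complex assume "z \<in> circle"
    then have "z = cis (Arg z)"
      by (metis cis_Arg_unique dist_0_norm mem_sphere cis_Arg sgn_div_norm
          inverse_1 scaleR_one norm_zero zero_neq_one)
    moreover have "cis ` closure \<rat> \<subseteq> closure (cis ` \<rat>)"
      by (rule continuous_image_closure_subset[of UNIV])
         (auto intro: continuous_intros)
    ultimately show "z \<in> closure (cis ` \<rat>)"
      by (metis Rats_closure_real UNIV_I imageI subsetD)
  qed
  have "rational_angle (cis p) (cis q)" if "p \<in> \<rat>" "q \<in> \<rat>" for p q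
    unfolding rational_angle_def
    using that by (intro bexI[of _ "q - p"]) (simp_all add: cis_mult)
  with dense show ?thesis
    by (auto simp: C3_vertex_set_def countable_rat)
qed

end

theory Submission
  imports Defs
begin

text \<open>
  Cut the circle counterclockwise from a vertex \<open>x\<close> into three equal arcs and let \<open>sector x y\<close> be the
  number 0, 1 or 2 of the arc containing \<open>y\<close>. Since \<open>pi\<close> is irrational (\<open>pi_not_Rats\<close>), no vertex
  lies on the boundary of an arc of another one, and \<open>sector y x = 2 - sector x y\<close> for distinct
  vertices. All three relations can be read off from the sectors, and none of them changes when the
  circle is reflected, which turns \<open>sector x y\<close> into \<open>sector y x\<close>.

  The theorem follows from two facts. On the one hand, an isomorphism between finite substructures
  keeps all sectors or reverses all of them (\<open>sector_preserved_or_reversed\<close>). Adjacent vertices have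
  sector 1 in both directions, so only pairs of non-adjacent vertices have an orientation. Edge and
  betweenness force two such pairs with a common vertex to be treated alike; separation does the
  same for two pairs on opposite sides of the circle, which edge and betweenness leave independent.

  On the other hand, a sector-preserving map from a finite subset of one vertex set to another vertex
  set extends to a sector-preserving bijection (\<open>sector_preserving_map_extends\<close>). This is a
  back-and-forth argument. One more point can always be added (\<open>one_point_extension\<close>): rotating the
  given points by multiples of a third of the circumference brings them all into the third that
  ends at the new point, and the image of the new point is found just beyond the last of the
  rotated images. Two different vertex sets are needed because a map that reverses the sectors is
  handled by composing it with complex conjugation, which a vertex set need not be closed under.
\<close>

section \<open>Irrationality of \<open>pi\<close>\<close>

text \<open>These are the integrals of Niven's proof. Two facts about them clash with \<open>pi = a / b\<close>: a
  three-term recurrence makes \<open>b ^ n * niven_integral n\<close> an integer, and the factorial makes it tend to 0.\<close>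

definition niven_integral :: "nat \<Rightarrow> real" where
  "niven_integral n = integral {0..pi} (\<lambda>x. (x * (pi - x)) ^ n / fact n * sin x)"

lemma niven_integrable: "(\<lambda>x. (x * (pi - x)) ^ n / fact n * sin x) integrable_on {0..pi}"
  by (intro integrable_continuous_interval continuous_intros) auto

lemma niven_integral_0: "niven_integral 0 = 2"
proof -
  have "((\<lambda>x. sin x) has_integral (- cos pi - (- cos 0))) {0..pi}"
    by (intro fundamental_theorem_of_calculus)
       (auto intro!: derivative_eq_intros simp flip: has_real_derivative_iff_has_vector_derivative)
  then show ?thesis
    by (simp add: niven_integral_def integral_unique)
qed

lemma niven_integral_1: "niven_integral 1 = 4"
proof -
  have "((\<lambda>x. x * (pi - x) * sin x) has_integral
      (((pi - 2 * pi) * sin pi - (pi * (pi - pi) + 2) * cos pi)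
        - ((pi - 2 * 0) * sin 0 - (0 * (pi - 0) + 2) * cos 0))) {0..pi}"
    by (intro fundamental_theorem_of_calculus)
       (auto intro!: derivative_eq_intros simp: algebra_simps
          simp flip: has_real_derivative_iff_has_vector_derivative)
  then show ?thesis
    by (simp add: niven_integral_def integral_unique)
qed

lemma niven_integral_Suc_Suc:
  "niven_integral (Suc (Suc n)) = of_nat (4 * n + 6) * niven_integral (Suc n) - pi\<^sup>2 * niven_integral n"
proof -
  \<comment> \<open>With \<open>u = x * (pi - x)\<close> one has \<open>u' ^ 2 = pi ^ 2 - 4 * u\<close> and \<open>u'' = - 2\<close>, so for \<open>n + 2\<close> the
    second derivative of \<open>g\<close> is a combination of \<open>g\<close> at \<open>n\<close> and \<open>n + 1\<close>; and \<open>(h + h'') * sin\<close> has the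
    antiderivative \<open>h' * sin - h * cos\<close>.\<close>
  define g :: "nat \<Rightarrow> real \<Rightarrow> real" where "g k x = (x * (pi - x)) ^ k / fact k" for k x
  have int: "(\<lambda>x. g k x * sin x) integrable_on {0..pi}" for k
    unfolding g_def by (rule niven_integrable)
  have I: "niven_integral k = integral {0..pi} (\<lambda>x. g k x * sin x)" for k
    by (simp add: niven_integral_def g_def)
  have g': "(g (Suc k) has_real_derivative (pi - 2 * x) * g k x) (at x within X)" for k x X
  proof -
    have "((\<lambda>x. (x * (pi - x)) ^ Suc k / fact (Suc k)) has_real_derivative
        real (Suc k) * (x * (pi - x)) ^ k * (pi - 2 * x) / fact (Suc k)) (at x within X)"
    proof (rule DERIV_cdivide)
      show "((\<lambda>x. (x * (pi - x)) ^ Suc k) has_real_derivative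
          real (Suc k) * (x * (pi - x)) ^ k * (pi - 2 * x)) (at x within X)"
        by (rule derivative_eq_intros refl)+ (simp add: algebra_simps del: of_nat_Suc)
    qed
    moreover have "real (Suc k) * (x * (pi - x)) ^ k * (pi - 2 * x) / fact (Suc k) = (pi - 2 * x) * g k x"
      by (simp add: g_def fact_Suc del: of_nat_Suc)
    ultimately show ?thesis unfolding g_def by (simp only:)
  qed
  have gS: "x * (pi - x) * g n x = (1 + real n) * g (Suc n) x" for x
    using of_nat_neq_0[of n, where ?'a = real] by (simp add: g_def)
  have "((\<lambda>x. g (Suc (Suc n)) x * sin x - of_nat (4 * n + 6) * (g (Suc n) x * sin x)
            + pi\<^sup>2 * (g n x * sin x)) has_integral
      (((pi - 2 * pi) * g (Suc n) pi * sin pi - g (Suc (Suc n)) pi * cos pi)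
        - ((pi - 2 * 0) * g (Suc n) 0 * sin 0 - g (Suc (Suc n)) 0 * cos 0))) {0..pi}"
  proof (intro fundamental_theorem_of_calculus)
    fix x :: real assume "x \<in> {0..pi}"
    have eq: "(pi - 2 * x) * ((pi - 2 * x) * g n x)
        = pi\<^sup>2 * g n x - 4 * ((1 + real n) * g (Suc n) x)"
      unfolding gS[symmetric] by (simp add: power2_eq_square algebra_simps)
    have "((\<lambda>x. (pi - 2 * x) * g (Suc n) x * sin x - g (Suc (Suc n)) x * cos x) has_real_derivative
        ((pi - 2 * x) * ((pi - 2 * x) * g n x) - 2 * g (Suc n) x) * sin x
          + (pi - 2 * x) * g (Suc n) x * cos x
          - ((pi - 2 * x) * g (Suc n) x * cos x - g (Suc (Suc n)) x * sin x)) (at x within {0..pi})"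
      by (rule derivative_eq_intros refl g')+ (simp add: algebra_simps)
    then show "((\<lambda>x. (pi - 2 * x) * g (Suc n) x * sin x - g (Suc (Suc n)) x * cos x) has_vector_derivative
        g (Suc (Suc n)) x * sin x - of_nat (4 * n + 6) * (g (Suc n) x * sin x)
            + pi\<^sup>2 * (g n x * sin x)) (at x within {0..pi})"
      unfolding eq has_real_derivative_iff_has_vector_derivative[symmetric]
      by (simp add: algebra_simps)
  qed auto
  then have "integral {0..pi} (\<lambda>x. g (Suc (Suc n)) x * sin x
      - of_nat (4 * n + 6) * (g (Suc n) x * sin x) + pi\<^sup>2 * (g n x * sin x)) = 0"
    by (simp add: g_def integral_unique)
  moreover have "integral {0..pi} (\<lambda>x. g (Suc (Suc n)) x * sin x
      - of_nat (4 * n + 6) * (g (Suc n) x * sin x) + pi\<^sup>2 * (g n x * sin x))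
    = niven_integral (Suc (Suc n)) - of_nat (4 * n + 6) * niven_integral (Suc n) + pi\<^sup>2 * niven_integral n"
    unfolding I
    by (subst integral_add integral_diff integral_mult_right;
        (intro integrable_add integrable_diff integrable_on_mult_right int)?)+ simp
  ultimately show ?thesis by simp
qed

lemma abs_niven_integral_le: "\<bar>niven_integral n\<bar> \<le> pi * ((pi\<^sup>2) ^ n / fact n)"
proof -
  have "norm (integral (cbox 0 pi) (\<lambda>x. (x * (pi - x)) ^ n / fact n * sin x))
      \<le> (pi\<^sup>2) ^ n / fact n * measure lborel (cbox 0 pi)"
  proof (rule integrable_bound)
    fix x :: real assume x: "x \<in> cbox 0 pi"
    have "\<bar>x * (pi - x)\<bar> ^ n \<le> (pi\<^sup>2) ^ n"
      using x by (intro power_mono) (auto simp: abs_mult power2_eq_square intro!: mult_mono)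
    then have "\<bar>x * (pi - x)\<bar> ^ n / fact n * \<bar>sin x\<bar> \<le> (pi\<^sup>2) ^ n / fact n * 1"
      by (intro mult_mono divide_right_mono) auto
    then show "norm ((x * (pi - x)) ^ n / fact n * sin x) \<le> (pi\<^sup>2) ^ n / fact n"
      by (simp add: abs_mult power_abs)
  qed (use niven_integrable in auto)
  then show ?thesis by (simp add: niven_integral_def mult.commute)
qed

text \<open>The scaled integrals are integers tending to 0, so they vanish from some index on. The recurrence
  can be run downwards, since the coefficient of its last term is nonzero, and carries this to index
  0, where the integral is 2.\<close>

lemma pi_not_Rats: "pi \<notin> \<rat>"
proof
  assume "pi \<in> \<rat>"
  then obtain a b :: int where b: "b > 0" and pi: "pi = of_int a / of_int b"
    by (metis Rats_cases')
  have bpi: "real_of_int b * pi = of_int a" using b by (subst pi) simp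
  define J where "J n = of_int b ^ n * niven_integral n" for n
  have rec: "J (Suc (Suc n)) = of_nat (4 * n + 6) * of_int b * J (Suc n) - (of_int a)\<^sup>2 * J n" for n
    unfolding J_def niven_integral_Suc_Suc bpi[symmetric]
    by (simp add: algebra_simps power2_eq_square)
  have int: "J n \<in> \<int> \<and> J (Suc n) \<in> \<int>" for n
  proof (induction n)
    case 0 then show ?case
      using niven_integral_1 by (simp add: J_def niven_integral_0)
  next
    case (Suc n) then show ?case unfolding rec
      by (auto intro!: Ints_diff Ints_mult Ints_power)
  qed
  have "(\<lambda>n. (of_int b * pi\<^sup>2) ^ n /\<^sub>R fact n) \<longlonglongrightarrow> 0"
    by (intro summable_LIMSEQ_zero summable_exp_generic)
  then have "(\<lambda>n. pi * ((of_int b * pi\<^sup>2) ^ n /\<^sub>R fact n)) \<longlonglongrightarrow> pi * 0"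
    by (rule tendsto_mult_left)
  then have "\<forall>\<^sub>F n in sequentially. pi * ((of_int b * pi\<^sup>2) ^ n /\<^sub>R fact n) < 1"
    by (rule order_tendstoD) simp
  then obtain N where N: "\<And>n. n \<ge> N \<Longrightarrow> pi * ((of_int b * pi\<^sup>2) ^ n /\<^sub>R fact n) < 1"
    by (auto simp: eventually_sequentially)
  have zero: "J n = 0" if "n \<ge> N" for n
  proof -
    have "\<bar>J n\<bar> \<le> of_int b ^ n * (pi * ((pi\<^sup>2) ^ n / fact n))"
      unfolding J_def abs_mult using b abs_niven_integral_le by (intro mult_mono) auto
    also have "\<dots> = pi * ((of_int b * pi\<^sup>2) ^ n /\<^sub>R fact n)"
      by (simp add: power_mult_distrib field_simps)
    also have "\<dots> < 1" using N that by blast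
    finally show ?thesis using int[of n] Ints_eq_abs_less1[of "J n" 0] by simp
  qed
  have "a \<noteq> 0" using pi by auto
  have "J n = 0 \<and> J (Suc n) = 0" if "n \<le> N" for n
    using that
  proof (induction rule: inc_induct)
    case base then show ?case using zero by simp
  next
    case (step n) then show ?case using rec[of n] \<open>a \<noteq> 0\<close> by auto
  qed
  then have "J 0 = 0" by blast
  then show False by (simp add: J_def niven_integral_0)
qed

section \<open>Sectors\<close>

text \<open>The unit of \<open>turn\<close> is a third of the circumference, so that adding 3 changes nothing and the
  boundaries of the sectors seen from \<open>turn a\<close> are the points \<open>turn (a + k)\<close> with \<open>k\<close> an integer.\<close>

definition turn :: "real \<Rightarrow> complex" where
  "turn t = cis (2 * pi / 3 * t)"

text \<open>Cut the circle counterclockwise from \<open>x\<close> into three arcs, each containing its first end-point but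
  not its last. The value is the number 0, 1 or 2 of the arc that contains \<open>y\<close>.\<close>

definition sector :: "complex \<Rightarrow> complex \<Rightarrow> int" where
  "sector x y = \<lfloor>ccw_length x y / (2 * pi / 3)\<rfloor>"

lemma turn_in_circle [simp]: "turn t \<in> circle"
  by (simp add: turn_def)

lemma norm_turn [simp]: "norm (turn t) = 1"
  by (simp add: turn_def)

lemma turn_nonzero [simp]: "turn t \<noteq> 0"
  by (simp add: turn_def)

lemma turn_divide: "turn s / turn t = turn (s - t)"
  by (simp add: turn_def cis_divide right_diff_distrib)

lemma turn_add_3: "turn (t + 3 * of_int k) = turn t"
proof -
  have "2 * pi / 3 * (t + 3 * of_int k) = 2 * pi / 3 * t + 2 * pi * of_int k"
    by (simp add: algebra_simps)
  then show ?thesis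
    unfolding turn_def by (simp only: cis_mult[symmetric] cis_multiple_2pi Ints_of_int mult_1_right)
qed

lemma Arg2pi_turn: "0 \<le> t \<Longrightarrow> t < 3 \<Longrightarrow> Arg2pi (turn t) = 2 * pi / 3 * t"
  by (rule Arg2pi_unique[of 1]) (auto simp: turn_def cis_conv_exp)

lemma ccw_length_turn:
  assumes "a \<le> b" "b < a + 3"
  shows "ccw_length (turn a) (turn b) = 2 * pi / 3 * (b - a)"
  using assms by (simp add: ccw_length_def turn_divide Arg2pi_turn)

text \<open>Every parameter can be moved into a prescribed window of length 3. The last clause records how this
  move acts on integer parts; it turns computations with sectors into arithmetic modulo 3.\<close>

lemma turn_reduce:
  obtains s where "turn s = turn t" "a \<le> s" "s < a + 3" "s - t \<in> \<int>"
    "\<lfloor>s - a\<rfloor> = \<lfloor>t - a\<rfloor> mod 3"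
proof -
  define k where "k = \<lfloor>t - a\<rfloor> div 3"
  define s where "s = t + 3 * of_int (- k)"
  have "\<lfloor>s - a\<rfloor> = \<lfloor>t - a\<rfloor> - 3 * k"
    unfolding s_def by linarith
  then have m: "\<lfloor>s - a\<rfloor> = \<lfloor>t - a\<rfloor> mod 3"
    unfolding k_def by (simp add: minus_mult_div_eq_mod)
  have "0 \<le> \<lfloor>s - a\<rfloor>" "\<lfloor>s - a\<rfloor> < 3" unfolding m by auto
  then have "a \<le> s" "s < a + 3" by linarith+
  moreover have "turn s = turn t" unfolding s_def by (rule turn_add_3)
  moreover have "s - t \<in> \<int>" by (simp add: s_def)
  ultimately show ?thesis using m that by blast
qed

lemma sector_turn: "sector (turn a) (turn b) = \<lfloor>b - a\<rfloor> mod 3"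
proof -
  obtain s where s: "turn s = turn b" "a \<le> s" "s < a + 3" "\<lfloor>s - a\<rfloor> = \<lfloor>b - a\<rfloor> mod 3"
    by (rule turn_reduce)
  have "ccw_length (turn a) (turn s) / (2 * pi / 3) = s - a"
    using s(2,3) by (simp add: ccw_length_turn)
  then show ?thesis unfolding sector_def s(1) s(4) by (simp only: s(4))
qed

lemma turn_inj:
  assumes "turn s = turn t" "a \<le> s" "s < a + 3" "a \<le> t" "t < a + 3"
  shows "s = t"
proof -
  have "2 * pi / 3 * (s - a) = 2 * pi / 3 * (t - a)"
    using ccw_length_turn[OF assms(2,3)] ccw_length_turn[OF assms(4,5)] assms(1) by metis
  then show ?thesis by simp
qed

lemma turn_eq_imp_Ints:
  assumes "turn s = turn t" shows "s - t \<in> \<int>"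
proof -
  obtain s' where s': "turn s' = turn s" "0 \<le> s'" "s' < 0 + 3" "s' - s \<in> \<int>" by (rule turn_reduce)
  obtain t' where t': "turn t' = turn t" "0 \<le> t'" "t' < 0 + 3" "t' - t \<in> \<int>" by (rule turn_reduce)
  have "s' = t'" using turn_inj[of s' t' 0] s' t' assms by simp
  then have "s - t = (t' - t) - (s' - s)" by simp
  then show ?thesis using s' t' by (metis Ints_diff)
qed

lemma circle_turnE:
  assumes "z \<in> circle"
  obtains t where "z = turn t" "a \<le> t" "t < a + 3"
proof -
  have "z \<noteq> 0" "sgn z = z" using assms by (auto simp: sgn_div_norm)
  then have "z = cis (Arg z)" by (simp add: cis_Arg)
  also have "\<dots> = turn (Arg z / (2 * pi / 3))" by (simp add: turn_def)
  finally show ?thesis by (metis turn_reduce that)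
qed

lemma ccw_length_self [simp]: "ccw_length x x = 0"
  by (cases "x = 0") (simp_all add: ccw_length_def Arg2pi_eq_0)

lemma sector_range: "sector x y \<in> {0, 1, 2}"
proof -
  have "0 \<le> ccw_length x y" "ccw_length x y < 3 * (2 * pi / 3)"
    using Arg2pi[of "y / x"] by (auto simp: ccw_length_def)
  then have "0 \<le> ccw_length x y / (2 * pi / 3)" "ccw_length x y / (2 * pi / 3) < 3"
    by (auto simp: field_simps)
  then have "0 \<le> sector x y" "sector x y < 3" unfolding sector_def by linarith+
  then show ?thesis by auto
qed

lemma sector_self [simp]: "sector x x = 0"
  by (simp add: sector_def)

lemma ccw_length_commute:
  assumes "x \<in> circle" "y \<in> circle" "x \<noteq> y"
  shows "ccw_length y x = 2 * pi - ccw_length x y"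
proof -
  obtain a where a: "x = turn a" using assms circle_turnE by metis
  obtain b where b: "y = turn b" "a \<le> b" "b < a + 3" using assms circle_turnE by metis
  have "a \<noteq> b" using assms a b by auto
  have "ccw_length (turn b) (turn (a + 3)) = 2 * pi / 3 * (a + 3 - b)"
    using b \<open>a \<noteq> b\<close> by (intro ccw_length_turn) auto
  then show ?thesis using a b turn_add_3[of a 1] by (simp add: ccw_length_turn field_simps)
qed

lemma circle_polar:
  assumes "x \<in> circle" "y \<in> circle"
  shows "y = x * cis (ccw_length x y)"
proof -
  have "x \<noteq> 0" and "norm (y / x) = 1" using assms by (auto simp: norm_divide)
  then show ?thesis using Arg2pi_eq[of "y / x"] by (simp add: ccw_length_def cis_conv_exp)
qed

lemma ccw_length_inj:
  assumes "x \<in> circle" "y \<in> circle" "z \<in> circle" "ccw_length x y = ccw_length x z"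
  shows "y = z"
  by (subst circle_polar[OF assms(1,2)], subst circle_polar[OF assms(1,3)]) (simp only: assms(4))

lemma mem_ccw_arc_iff:
  assumes "x \<in> circle" "y \<in> circle"
  shows "y \<in> ccw_arc x z \<longleftrightarrow> ccw_length x y \<le> ccw_length x z"
proof
  have nz: "x \<noteq> 0" using assms by auto
  have bound: "ccw_length x z < 2 * pi" unfolding ccw_length_def by (rule Arg2pi_lt_2pi)
  assume "y \<in> ccw_arc x z"
  then obtain t where t: "y = x * cis t" "0 \<le> t" "t \<le> ccw_length x z" unfolding ccw_arc_def by force
  then have "Arg2pi (y / x) = t"
    using bound nz by (intro Arg2pi_unique[of 1]) (auto simp: cis_conv_exp)
  then show "ccw_length x y \<le> ccw_length x z" using t by (simp add: ccw_length_def)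
next
  assume le: "ccw_length x y \<le> ccw_length x z"
  have "y = x * cis (ccw_length x y)" using assms by (rule circle_polar)
  moreover have "0 \<le> ccw_length x y" by (simp add: ccw_length_def Arg2pi_ge_0)
  ultimately show "y \<in> ccw_arc x z" using le unfolding ccw_arc_def by auto
qed

lemma ccw_length_cnj:
  assumes "x \<in> circle" "y \<in> circle"
  shows "ccw_length (cnj x) (cnj y) = ccw_length y x"
proof -
  have nz: "x \<noteq> 0" "y \<noteq> 0" using assms by auto
  have "cnj x = 1 / x" "cnj y = 1 / y"
    using assms nz by (simp_all add: field_simps complex_norm_square[symmetric] mult.commute[of "cnj _"])
  then show ?thesis using nz by (simp add: ccw_length_def)
qed

lemma sector_cnj: "x \<in> circle \<Longrightarrow> y \<in> circle \<Longrightarrow> sector (cnj x) (cnj y) = sector y x"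
  by (simp add: sector_def ccw_length_cnj)

text \<open>The cyclic order is determined by the sectors: if \<open>y\<close> and \<open>z\<close> lie in the same sector seen from \<open>x\<close>,
  they are less than a third of the circumference apart, so \<open>sector y z = 0\<close> says that \<open>z\<close> comes
  later.\<close>

lemma ccw_length_less_iff:
  assumes "x \<in> circle" "y \<in> circle" "z \<in> circle" "y \<noteq> z"
  shows "ccw_length x y < ccw_length x z \<longleftrightarrow>
    sector x y < sector x z \<or> sector x y = sector x z \<and> sector y z = 0"
proof -
  obtain a where a: "x = turn a" using assms circle_turnE by metis
  obtain b where b: "y = turn b" "a \<le> b" "b < a + 3" using assms circle_turnE by metis
  obtain c where c: "z = turn c" "a \<le> c" "c < a + 3" using assms circle_turnE by metis
  have "b \<noteq> c" using assms b c by auto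
  have less: "ccw_length x y < ccw_length x z \<longleftrightarrow> b < c"
    using a b c by (simp add: ccw_length_turn)
  have range: "\<lfloor>b - a\<rfloor> mod 3 = \<lfloor>b - a\<rfloor>" "\<lfloor>c - a\<rfloor> mod 3 = \<lfloor>c - a\<rfloor>"
    using b c by (auto intro!: mod_pos_pos_trivial simp: floor_less_iff)
  have "b < c \<longleftrightarrow> \<lfloor>b - a\<rfloor> < \<lfloor>c - a\<rfloor> \<or> \<lfloor>b - a\<rfloor> = \<lfloor>c - a\<rfloor> \<and> \<lfloor>c - b\<rfloor> mod 3 = 0"
  proof (cases "\<lfloor>b - a\<rfloor> = \<lfloor>c - a\<rfloor>")
    case True
    then have "\<bar>c - b\<bar> < 1" by linarith
    then have "\<lfloor>c - b\<rfloor> = (if b < c then 0 else -1)"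
      using \<open>b \<noteq> c\<close> by (auto simp: floor_eq_iff)
    then show ?thesis using True by simp
  qed linarith
  then show ?thesis unfolding less using a b c range by (simp add: sector_turn)
qed

section \<open>Vertex sets without points a multiple of a third apart\<close>

text \<open>Injectivity of the cube says that no two points differ by a rotation by one or two thirds of the
  circumference, so no point of \<open>V\<close> lies on the boundary of a sector seen from another one. The
  rationality of the angles in \<open>C3_vertex_set\<close> is used in this form.\<close>

definition generic_vertices :: "complex set \<Rightarrow> bool" where
  "generic_vertices V \<longleftrightarrow>
     V \<subseteq> circle \<and> countable V \<and> circle \<subseteq> closure V \<and> inj_on (\<lambda>z. z ^ 3) V"

lemma turn_cubed: "turn a ^ 3 = cis (2 * pi * a)"
  unfolding turn_def Complex.DeMoivre by (simp add: mult.assoc)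

text \<open>If a rational angle \<open>q\<close> satisfies \<open>cis (3 * q) = 1\<close>, then \<open>3 * q\<close> is an integer multiple of
  \<open>2 * pi\<close>, hence 0 because \<open>pi\<close> is irrational.\<close>

lemma C3_vertex_set_generic:
  assumes "C3_vertex_set V" shows "generic_vertices V"
proof -
  have "x = y" if xy: "x \<in> V" "y \<in> V" "x ^ 3 = y ^ 3" for x y
  proof (rule ccontr)
    assume "x \<noteq> y"
    then obtain q where q: "q \<in> \<rat>" "y = x * cis q"
      using assms xy unfolding C3_vertex_set_def rational_angle_def by blast
    have "x \<noteq> 0" using assms xy by (auto simp: C3_vertex_set_def)
    then have "cis (3 * q) = 1"
      using xy q by (auto simp: power_mult_distrib Complex.DeMoivre)
    then have "cos (3 * q) = 1" by (simp add: complex_eq_iff)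
    then obtain k :: int where k: "3 * q = of_int k * 2 * pi" by (auto simp: cos_one_2pi_int)
    show False
    proof (cases "k = 0")
      case True
      then have "q = 0" using k by simp
      then show False using q(2) \<open>x \<noteq> y\<close> by simp
    next
      case False
      then have "pi = 3 * q / (2 * of_int k)" using k by (simp add: field_simps)
      also have "\<dots> \<in> \<rat>" using q(1) by (intro Rats_divide Rats_mult) auto
      finally have "pi \<in> \<rat>" .
      then show False using pi_not_Rats by blast
    qed
  qed
  then have "inj_on (\<lambda>z. z ^ 3) V" by (rule inj_onI)
  then show ?thesis using assms unfolding C3_vertex_set_def generic_vertices_def by blast
qed

lemma generic_vertices_turn:
  assumes "generic_vertices V" "turn a \<in> V" "turn b \<in> V" "turn a \<noteq> turn b"
  shows "b - a \<notin> \<int>"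
proof
  assume "b - a \<in> \<int>"
  then have "cis (2 * pi * (b - a)) = 1" by simp
  moreover have "turn b ^ 3 = turn a ^ 3 * cis (2 * pi * (b - a))"
    by (simp add: turn_cubed cis_mult right_diff_distrib)
  ultimately have "turn a ^ 3 = turn b ^ 3" by simp
  then show False using assms unfolding generic_vertices_def inj_on_def by blast
qed

lemma generic_vertices_turnE:
  assumes "generic_vertices V" "x \<in> V" "y \<in> V" "x \<noteq> y"
  obtains a b where "x = turn a" "y = turn b" "a < b" "b < a + 3" "b - a \<notin> \<int>"
proof -
  have "x \<in> circle" "y \<in> circle" using assms by (auto simp: generic_vertices_def)
  then obtain a where a: "x = turn a" using circle_turnE by metis
  obtain b where b: "y = turn b" "a \<le> b" "b < a + 3" using \<open>y \<in> circle\<close> circle_turnE by metis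
  have "b - a \<notin> \<int>" using generic_vertices_turn[of V a b] assms a b by blast
  moreover have "a \<noteq> b" using assms(4) a b(1) by blast
  ultimately show ?thesis using that[OF a b(1)] b by linarith
qed

text \<open>Seen from \<open>y\<close>, the difference of the parameters changes its sign. As it is not an integer, its
  integer part changes from \<open>n\<close> to \<open>- n - 1\<close>, which is \<open>2 - n\<close> modulo 3.\<close>

lemma sector_commute:
  assumes "generic_vertices V" "x \<in> V" "y \<in> V" "x \<noteq> y"
  shows "sector y x = 2 - sector x y"
proof -
  obtain a b where ab: "x = turn a" "y = turn b" "b - a \<notin> \<int>"
    using generic_vertices_turnE[OF assms] by metis
  have "\<lfloor>a - b\<rfloor> = - \<lfloor>b - a\<rfloor> - 1"
  proof -
    have "of_int \<lfloor>b - a\<rfloor> \<noteq> b - a" using ab(3) by (metis Ints_of_int)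
    then show ?thesis by linarith
  qed
  then show ?thesis unfolding ab sector_turn by presburger
qed

lemma sector_eq_0_imp_eq:
  assumes "generic_vertices V" "x \<in> V" "y \<in> V" "sector x y = 0" "sector y x = 0"
  shows "x = y"
  using sector_commute[OF assms(1-3)] assms(4,5) by force

text \<open>A vertex set need not be closed under reflection, so orientation-reversing maps are treated as
  orientation-preserving maps into the reflected vertex set.\<close>

lemma generic_vertices_cnj:
  assumes "generic_vertices V" shows "generic_vertices (cnj ` V)"
proof -
  have "circle \<subseteq> closure (cnj ` V)"
  proof
    fix z :: complex assume "z \<in> circle"
    then have "cnj z \<in> closure V" using assms by (auto simp: generic_vertices_def)
    then have "cnj (cnj z) \<in> cnj ` closure V" by blast
    then show "z \<in> closure (cnj ` V)"
      using closure_bounded_linear_image_subset[OF bounded_linear_cnj, of V] by auto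
  qed
  then show ?thesis using assms
    by (auto simp: generic_vertices_def inj_on_def simp flip: complex_cnj_power)
qed

section \<open>The three relations in terms of sectors\<close>

lemma C3_edge_iff:
  assumes "generic_vertices V" "x \<in> V" "y \<in> V"
  shows "C3_edge x y \<longleftrightarrow> sector x y = 1"
proof (cases "x = y")
  case True then show ?thesis by (simp add: C3_edge_def)
next
  case False
  obtain a b where ab: "x = turn a" "y = turn b" "a < b" "b < a + 3" "b - a \<notin> \<int>"
    using generic_vertices_turnE[OF assms False] by metis
  have xy: "ccw_length x y = 2 * pi / 3 * (b - a)" using ab by (simp add: ccw_length_turn)
  have "ccw_length y x = 2 * pi / 3 * (3 - (b - a))"
    using ccw_length_commute[of x y] False xy turn_in_circle unfolding ab by (simp add: field_simps del: turn_in_circle mem_sphere)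
  then have "C3_edge x y \<longleftrightarrow> 2 * pi / 3 * 1 < 2 * pi / 3 * (b - a) \<and> 2 * pi / 3 * 1 < 2 * pi / 3 * (3 - (b - a))"
    unfolding C3_edge_def xy by (simp only: mult_1_right) (simp add: mult.commute)
  also have "\<dots> \<longleftrightarrow> 1 < b - a \<and> b - a < 2"
    by (subst (1 2) mult_less_cancel_left_pos) auto
  also have "\<dots> \<longleftrightarrow> 1 \<le> b - a \<and> b - a < 2"
    using ab(5) by (metis Ints_1 order_le_less)
  also have "\<dots> \<longleftrightarrow> \<lfloor>b - a\<rfloor> = 1" by (simp add: floor_eq_iff)
  also have "\<dots> \<longleftrightarrow> sector x y = 1"
    unfolding ab sector_turn using ab by (subst mod_pos_pos_trivial) (auto simp: floor_less_iff)
  finally show ?thesis .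
qed

text \<open>Points in the same sector seen from \<open>x\<close> are less than a third of the circumference apart. Hence
  two points that are near \<open>x\<close> on the same side of it are not adjacent.\<close>

lemma sector_eq_not_edge:
  assumes "x \<in> circle" "y \<in> circle" "z \<in> circle" "sector x y = sector x z"
  shows "sector y z \<noteq> 1"
proof -
  obtain a where a: "x = turn a" using assms circle_turnE by metis
  obtain b where b: "y = turn b" "a \<le> b" "b < a + 3" using assms circle_turnE by metis
  obtain c where c: "z = turn c" "a \<le> c" "c < a + 3" using assms circle_turnE by metis
  have "\<lfloor>b - a\<rfloor> mod 3 = \<lfloor>b - a\<rfloor>" "\<lfloor>c - a\<rfloor> mod 3 = \<lfloor>c - a\<rfloor>"
    using b c by (auto intro!: mod_pos_pos_trivial simp: floor_less_iff)
  then have "\<lfloor>b - a\<rfloor> = \<lfloor>c - a\<rfloor>" using assms a b c by (simp add: sector_turn)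
  then have "-1 < c - b" "c - b < 1" by linarith+
  then have "\<lfloor>c - b\<rfloor> = 0 \<or> \<lfloor>c - b\<rfloor> = -1" by linarith
  then show ?thesis using b c by (auto simp: sector_turn)
qed

lemma sector_zero_zero:
  assumes "x \<in> circle" "y \<in> circle" "z \<in> circle" "sector x y = 0" "sector y z = 0"
  shows "sector x z \<noteq> 2"
proof -
  obtain a where a: "x = turn a" using assms circle_turnE by metis
  obtain b where b: "y = turn b" "a \<le> b" "b < a + 3" using assms circle_turnE by metis
  obtain c where c: "z = turn c" "b \<le> c" "c < b + 3" using assms circle_turnE by metis
  have "\<lfloor>b - a\<rfloor> mod 3 = \<lfloor>b - a\<rfloor>" "\<lfloor>c - b\<rfloor> mod 3 = \<lfloor>c - b\<rfloor>"
    using b c by (auto intro!: mod_pos_pos_trivial simp: floor_less_iff)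
  then have "\<lfloor>b - a\<rfloor> = 0" "\<lfloor>c - b\<rfloor> = 0" using assms a b c by (simp_all add: sector_turn)
  then have "\<lfloor>c - a\<rfloor> = 0 \<or> \<lfloor>c - a\<rfloor> = 1" by linarith
  then show ?thesis using a c by (auto simp: sector_turn)
qed

lemma sector_zero_ccw_length:
  assumes "x \<in> circle" "z \<in> circle" "x \<noteq> z" "sector x z = 0"
  shows "ccw_length x z < ccw_length z x"
proof -
  have "ccw_length x z / (2 * pi / 3) < 1" using assms(4) unfolding sector_def by linarith
  then have "3 * ccw_length x z < 2 * pi" by (simp add: field_simps)
  moreover have "0 \<le> ccw_length x z" by (simp add: ccw_length_def Arg2pi_ge_0)
  ultimately show ?thesis using ccw_length_commute[OF assms(1-3)] by linarith
qed

lemma mem_ccw_arc_sector_zero: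
  assumes "x \<in> circle" "y \<in> circle" "z \<in> circle" "y \<noteq> z" "sector x z = 0"
  shows "y \<in> ccw_arc x z \<longleftrightarrow> sector x y = 0 \<and> sector y z = 0"
proof -
  have "ccw_length x y \<noteq> ccw_length x z" using ccw_length_inj assms by blast
  then have "y \<in> ccw_arc x z \<longleftrightarrow> ccw_length x y < ccw_length x z"
    using assms by (simp only: mem_ccw_arc_iff order_le_less) blast
  then show ?thesis
    using ccw_length_less_iff[of x y z] sector_range[of x y] assms by auto
qed

text \<open>Since \<open>x\<close> and \<open>z\<close> are not adjacent, the shorter arc between them is shorter than a third of the
  circumference. A point on it cuts it into two arcs, which are again shorter than a third; two
  consecutive arcs of that kind conversely fit together to the shorter arc, as together they cannot
  reach the last third.\<close>

lemma C3_between_iff: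
  assumes V: "generic_vertices V" and mem: "x \<in> V" "y \<in> V" "z \<in> V"
  shows "C3_between x y z \<longleftrightarrow> distinct [x, y, z] \<and>
    sector x y \<noteq> 1 \<and> sector y z \<noteq> 1 \<and> sector x z \<noteq> 1 \<and>
    (sector x y = 0 \<and> sector y z = 0 \<or> sector z y = 0 \<and> sector y x = 0)"
proof (cases "distinct [x, y, z]")
  case True
  have circ: "x \<in> circle" "y \<in> circle" "z \<in> circle"
    using V mem by (auto simp: generic_vertices_def)
  have comm: "sector y x = 2 - sector x y" "sector z y = 2 - sector y z" "sector z x = 2 - sector x z"
    using sector_commute[OF V] mem True by auto
  have indep: "C3_independent {x, y, z} \<longleftrightarrow> sector x y \<noteq> 1 \<and> sector y z \<noteq> 1 \<and> sector x z \<noteq> 1"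
    unfolding C3_independent_def using C3_edge_iff[OF V] mem comm by auto
  show ?thesis
  proof (cases "C3_independent {x, y, z}")
    case ind: True
    then have "sector x z = 0 \<or> sector z x = 0"
      using indep sector_range[of x z] comm by auto
    then show ?thesis
    proof
      assume 0: "sector x z = 0"
      have "on_shorter_arc x z y \<longleftrightarrow> sector x y = 0 \<and> sector y z = 0"
        using sector_zero_ccw_length[of x z] mem_ccw_arc_sector_zero[of x y z] circ 0 True
        by (auto simp: on_shorter_arc_def)
      moreover have "\<not> (sector z y = 0 \<and> sector y x = 0)"
        using sector_zero_zero[of z y x] circ 0 comm by auto
      ultimately show ?thesis using True ind indep unfolding C3_between_def by blast
    next
      assume 0: "sector z x = 0"
      have "on_shorter_arc x z y \<longleftrightarrow> sector z y = 0 \<and> sector y x = 0"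
        using sector_zero_ccw_length[of z x] mem_ccw_arc_sector_zero[of z y x] circ 0 True
        by (auto simp: on_shorter_arc_def)
      moreover have "\<not> (sector x y = 0 \<and> sector y z = 0)"
        using sector_zero_zero[of x y z] circ 0 comm by auto
      ultimately show ?thesis using True ind indep unfolding C3_between_def by blast
    qed
  qed (use indep in \<open>auto simp: C3_between_def\<close>)
qed (auto simp: C3_between_def)

text \<open>The two closed arcs between \<open>turn a\<close> and \<open>turn c\<close> cover the circle and meet only in their
  end-points, so their complements separate the open arcs.\<close>

lemma not_connected_component_turn:
  assumes "a < b" "b < c" "c < d" "d < a + 3"
  shows "\<not> connected_component (circle - {turn a, turn c}) (turn b) (turn d)"
proof
  assume "connected_component (circle - {turn a, turn c}) (turn b) (turn d)"
  then obtain T where T: "connected T" "T \<subseteq> circle - {turn a, turn c}" "turn b \<in> T" "turn d \<in> T"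
    by (auto simp: connected_component_def)
  define K where "K = turn ` {a..c}"
  define L where "L = turn ` {c..a + 3}"
  have "closed K" "closed L"
    unfolding K_def L_def turn_def
    by (intro compact_imp_closed compact_continuous_image continuous_intros compact_Icc)+
  then have "open (- K)" "open (- L)" by auto
  moreover have "circle \<subseteq> K \<union> L"
  proof
    fix z :: complex assume "z \<in> circle"
    then obtain t where "z = turn t" "a \<le> t" "t < a + 3" by (rule circle_turnE)
    then show "z \<in> K \<union> L" unfolding K_def L_def by (cases "t \<le> c") auto
  qed
  then have "(- K) \<inter> (- L) \<inter> T = {}" using T(2) by blast
  moreover have "K \<inter> L \<subseteq> {turn a, turn c}"
  proof
    fix z assume "z \<in> K \<inter> L"
    then obtain s where s: "z = turn s" "a \<le> s" "s \<le> c" unfolding K_def by auto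
    obtain t where t: "z = turn t" "c \<le> t" "t \<le> a + 3"
      using \<open>z \<in> K \<inter> L\<close> unfolding L_def by auto
    note st = s t
    show "z \<in> {turn a, turn c}"
    proof (cases "t = a + 3")
      case True then show ?thesis using st turn_add_3[of a 1] by simp
    next
      case False
      then have "s = t" using turn_inj[of s t a] st assms by simp
      then show ?thesis using st by auto
    qed
  qed
  then have "T \<subseteq> (- K) \<union> (- L)" using T(2) by blast
  ultimately have "(- K) \<inter> T = {} \<or> (- L) \<inter> T = {}"
    using connectedD[OF T(1)] by blast
  moreover have "turn b \<in> K" "turn d \<in> L" unfolding K_def L_def using assms by auto
  ultimately have "turn d \<in> K \<or> turn b \<in> L" using T(3,4) by blast
  then show False
  proof
    assume "turn d \<in> K"
    then obtain s where "turn d = turn s" "a \<le> s" "s \<le> c" unfolding K_def by auto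
    then show False using turn_inj[of d s a] assms by simp
  next
    assume "turn b \<in> L"
    then obtain s where s: "turn b = turn s" "c \<le> s" "s \<le> a + 3" unfolding L_def by auto
    then show False
      using turn_inj[of b s a] turn_inj[of b a a] turn_add_3[of a 1] assms by (cases "s = a + 3") auto
  qed
qed

lemma connected_component_turn:
  assumes "connected I" "I \<subseteq> {a<..<a + 3} - {c}" "b \<in> I" "d \<in> I" "a < c" "c < a + 3"
  shows "connected_component (circle - {turn a, turn c}) (turn b) (turn d)"
proof (rule connected_componentI[of "turn ` I"])
  show "connected (turn ` I)"
    unfolding turn_def by (intro connected_continuous_image continuous_intros assms)
  have "turn t \<notin> {turn a, turn c}" if "t \<in> I" for t
    using turn_inj[of t a a] turn_inj[of t c a] assms that by fastforce
  then show "turn ` I \<subseteq> circle - {turn a, turn c}" using turn_in_circle by (auto simp del: mem_sphere)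
qed (use assms in auto)

lemma C3_separation_iff:
  assumes circ: "x1 \<in> circle" "x2 \<in> circle" "x3 \<in> circle" "x4 \<in> circle"
  shows "C3_separation x1 x2 x3 x4 \<longleftrightarrow> distinct [x1, x2, x3, x4] \<and>
    (ccw_length x1 x2 < ccw_length x1 x3) \<noteq> (ccw_length x1 x4 < ccw_length x1 x3)"
proof (cases "distinct [x1, x2, x3, x4]")
  case True
  let ?S = "circle - {x1, x3}"
  have "(\<exists>C \<in> components ?S. \<exists>D \<in> components ?S. C \<noteq> D \<and> x2 \<in> C \<and> x4 \<in> D)
      \<longleftrightarrow> \<not> connected_component ?S x2 x4"
  proof -
    have mem: "x2 \<in> ?S" "x4 \<in> ?S" using True circ by auto
    have own: "C = connected_component_set ?S x" if "C \<in> components ?S" "x \<in> C" for C x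
      using that connected_component_eq unfolding components_def by blast
    have "x \<in> connected_component_set ?S x \<and> connected_component_set ?S x \<in> components ?S"
      if "x \<in> ?S" for x
      using that by (simp only: mem_Collect_eq connected_component_refl_eq componentsI)
    then have "(\<exists>C \<in> components ?S. \<exists>D \<in> components ?S. C \<noteq> D \<and> x2 \<in> C \<and> x4 \<in> D)
        \<longleftrightarrow> connected_component_set ?S x2 \<noteq> connected_component_set ?S x4"
      using mem own by (intro iffI) (blast, metis)
    then show ?thesis using mem unfolding connected_component_eq_eq by blast
  qed
  moreover obtain a where a: "x1 = turn a" using circ circle_turnE by metis
  obtain b where b: "x2 = turn b" "a \<le> b" "b < a + 3" using circ circle_turnE by metis
  obtain c where c: "x3 = turn c" "a \<le> c" "c < a + 3" using circ circle_turnE by metis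
  obtain d where d: "x4 = turn d" "a \<le> d" "d < a + 3" using circ circle_turnE by metis
  have ne: "a \<noteq> b" "a \<noteq> c" "a \<noteq> d" "b \<noteq> c" "c \<noteq> d" using True a b c d by auto
  then have lt: "a < b" "a < c" "a < d" using b c d by auto
  have "connected_component ?S x2 x4 \<longleftrightarrow> (b < c \<longleftrightarrow> d < c)"
  proof (cases "b < c"; cases "d < c")
    assume "b < c" "d < c"
    moreover have "{a<..<c} \<subseteq> {a<..<a + 3} - {c}" using c by auto
    ultimately show ?thesis using connected_component_turn[of "{a<..<c}" a c b d] a b c d lt by auto
  next
    assume "\<not> b < c" "\<not> d < c"
    moreover have "{c<..<a+3} \<subseteq> {a<..<a + 3} - {c}" using c by auto
    ultimately show ?thesis using connected_component_turn[of "{c<..<a+3}" a c b d] a b c d lt ne by auto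
  next
    assume *: "b < c" "\<not> d < c"
    then have "c < d" using ne by simp
    then show ?thesis using not_connected_component_turn[of a b c d] * a b c d lt by auto
  next
    assume *: "\<not> b < c" "d < c"
    then have "c < b" using ne by simp
    then show ?thesis
      using not_connected_component_turn[of a d c b] connected_component_sym * a b c d lt by metis
  qed
  moreover have "ccw_length x1 x2 < ccw_length x1 x3 \<longleftrightarrow> b < c"
    "ccw_length x1 x4 < ccw_length x1 x3 \<longleftrightarrow> d < c"
    using a b c d by (simp_all add: ccw_length_turn)
  ultimately show ?thesis using True by (simp add: C3_separation_def)
qed (auto simp: C3_separation_def)

text \<open>The characterisations of edge and betweenness speak of sectors only, and that of separation
  compares arc lengths, that is, the cyclic order, which sectors determine as well.\<close>

lemma sector_preserving_relations:
  assumes V: "generic_vertices V" and W: "generic_vertices W"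
    and g: "bij_betw g V W"
    and pres: "\<And>x y. x \<in> V \<Longrightarrow> y \<in> V \<Longrightarrow> sector (g x) (g y) = sector x y"
  shows "\<And>x y. x \<in> V \<Longrightarrow> y \<in> V \<Longrightarrow> C3_edge (g x) (g y) \<longleftrightarrow> C3_edge x y"
    and "\<And>x y z. x \<in> V \<Longrightarrow> y \<in> V \<Longrightarrow> z \<in> V \<Longrightarrow>
      C3_between (g x) (g y) (g z) \<longleftrightarrow> C3_between x y z"
    and "\<And>x y u v. x \<in> V \<Longrightarrow> y \<in> V \<Longrightarrow> u \<in> V \<Longrightarrow> v \<in> V \<Longrightarrow>
      C3_separation (g x) (g y) (g u) (g v) \<longleftrightarrow> C3_separation x y u v"
proof -
  have gW: "g x \<in> W" if "x \<in> V" for x using g that by (rule bij_betwE[rule_format])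
  have inj: "g x = g y \<longleftrightarrow> x = y" if "x \<in> V" "y \<in> V" for x y
    using g that by (auto simp: bij_betw_def dest: inj_onD)
  have circ: "x \<in> circle" "g x \<in> circle" if "x \<in> V" for x
    using that gW V W unfolding generic_vertices_def by blast+
  show "C3_edge (g x) (g y) \<longleftrightarrow> C3_edge x y" if "x \<in> V" "y \<in> V" for x y
    using that by (simp only: C3_edge_iff[OF V] C3_edge_iff[OF W] gW pres)
  show "C3_between (g x) (g y) (g z) \<longleftrightarrow> C3_between x y z" if "x \<in> V" "y \<in> V" "z \<in> V" for x y z
    using that by (simp add: C3_between_iff[OF V] C3_between_iff[OF W] gW pres inj)
  show "C3_separation (g x) (g y) (g u) (g v) \<longleftrightarrow> C3_separation x y u v"
    if "x \<in> V" "y \<in> V" "u \<in> V" "v \<in> V" for x y u v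
  proof (cases "distinct [x, y, u, v]")
    case True
    have "ccw_length (g x) (g w) < ccw_length (g x) (g u) \<longleftrightarrow> ccw_length x w < ccw_length x u"
      if "w \<in> V" "w \<noteq> u" for w
      using that \<open>x \<in> V\<close> \<open>u \<in> V\<close> circ by (simp add: ccw_length_less_iff pres inj del: mem_sphere)
    then have "ccw_length (g x) (g y) < ccw_length (g x) (g u) \<longleftrightarrow> ccw_length x y < ccw_length x u"
      "ccw_length (g x) (g v) < ccw_length (g x) (g u) \<longleftrightarrow> ccw_length x v < ccw_length x u"
      using that True by auto
    then show ?thesis using that circ by (simp add: C3_separation_iff inj del: mem_sphere)
  qed (use that inj in \<open>auto simp: C3_separation_def\<close>)
qed

text \<open>Reflection exchanges \<open>sector x y\<close> with \<open>sector y x\<close> and reverses all comparisons of arcs from a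
  fixed point. Edge and betweenness are symmetric under reversal, and separation asks whether two such
  comparisons differ, which is unchanged when both are negated.\<close>

lemma cnj_relations:
  shows "\<And>x y. x \<in> circle \<Longrightarrow> y \<in> circle \<Longrightarrow> C3_edge (cnj x) (cnj y) \<longleftrightarrow> C3_edge x y"
    and "\<And>x y z. generic_vertices V \<Longrightarrow> x \<in> V \<Longrightarrow> y \<in> V \<Longrightarrow> z \<in> V \<Longrightarrow>
      C3_between (cnj x) (cnj y) (cnj z) \<longleftrightarrow> C3_between x y z"
    and "\<And>x y u v. x \<in> circle \<Longrightarrow> y \<in> circle \<Longrightarrow> u \<in> circle \<Longrightarrow> v \<in> circle \<Longrightarrow>
      C3_separation (cnj x) (cnj y) (cnj u) (cnj v) \<longleftrightarrow> C3_separation x y u v"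
proof -
  show "C3_edge (cnj x) (cnj y) \<longleftrightarrow> C3_edge x y" if "x \<in> circle" "y \<in> circle" for x y
    unfolding C3_edge_def ccw_length_cnj[OF that] ccw_length_cnj[OF that(2,1)] by blast
  show "C3_between (cnj x) (cnj y) (cnj z) \<longleftrightarrow> C3_between x y z"
    if "generic_vertices V" "x \<in> V" "y \<in> V" "z \<in> V" for x y z
  proof -
    have circ: "x \<in> circle" "y \<in> circle" "z \<in> circle" using that by (auto simp: generic_vertices_def)
    have "C3_between (cnj x) (cnj y) (cnj z) \<longleftrightarrow> distinct [x, y, z] \<and>
      sector y x \<noteq> 1 \<and> sector z y \<noteq> 1 \<and> sector z x \<noteq> 1 \<and>
      (sector y x = 0 \<and> sector z y = 0 \<or> sector y z = 0 \<and> sector x y = 0)"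
      using C3_between_iff[OF generic_vertices_cnj[OF that(1)], of "cnj x" "cnj y" "cnj z"]
        that sector_cnj circ by simp
    moreover have "sector y x = 2 - sector x y" "sector z y = 2 - sector y z"
        "sector z x = 2 - sector x z" if "distinct [x, y, z]"
      using sector_commute[OF \<open>generic_vertices V\<close>] \<open>x \<in> V\<close> \<open>y \<in> V\<close> \<open>z \<in> V\<close> that by simp_all
    ultimately show ?thesis
      unfolding C3_between_iff[OF that] by (cases "distinct [x, y, z]") auto
  qed
  show "C3_separation (cnj x) (cnj y) (cnj u) (cnj v) \<longleftrightarrow> C3_separation x y u v"
    if c: "x \<in> circle" "y \<in> circle" "u \<in> circle" "v \<in> circle" for x y u v
  proof (cases "distinct [x, y, u, v]")
    case True
    have flip: "ccw_length (cnj x) (cnj w) < ccw_length (cnj x) (cnj u) \<longleftrightarrow>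
        \<not> ccw_length x w < ccw_length x u" if w: "w \<in> circle" "x \<noteq> w" "w \<noteq> u" for w
    proof -
      have "ccw_length x w \<noteq> ccw_length x u" using ccw_length_inj[OF c(1) w(1) c(3)] w(3) by blast
      moreover have "ccw_length w x = 2 * pi - ccw_length x w"
        using ccw_length_commute[OF c(1) w(1)] w(2) by blast
      moreover have "ccw_length u x = 2 * pi - ccw_length x u"
        using ccw_length_commute[OF c(1) c(3)] True by simp
      ultimately show ?thesis
        unfolding ccw_length_cnj[OF c(1) w(1)] ccw_length_cnj[OF c(1) c(3)] by linarith
    qed
    have "cnj x \<in> circle" "cnj y \<in> circle" "cnj u \<in> circle" "cnj v \<in> circle" using c by simp_all
    moreover have "x \<noteq> y" "y \<noteq> u" "x \<noteq> v" "v \<noteq> u" using True by auto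
    ultimately show ?thesis using c by (simp add: C3_separation_iff flip del: mem_sphere)
  qed (auto simp: C3_separation_def)
qed

section \<open>Isomorphisms keep or reverse all sectors\<close>

text \<open>This is how edge and betweenness transport orientation from one pair of non-adjacent vertices to
  another one sharing a vertex. If \<open>y\<close> and \<open>z\<close> are both within a third of the circumference from
  \<open>x\<close>, they are on the same side of \<open>x\<close> unless they are adjacent or have \<open>x\<close> between them.\<close>

lemma between_detects_turning_back:
  assumes V: "generic_vertices V" "x \<in> V" "y \<in> V" "z \<in> V" "distinct [x, y, z]"
    and "sector x y \<noteq> 1" "sector x z \<noteq> 1"
  shows "sector x y = sector x z \<longleftrightarrow> \<not> C3_edge y z \<and> \<not> C3_between y x z"
proof -
  have comm: "sector y x = 2 - sector x y" "sector z x = 2 - sector x z"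
    using sector_commute V by auto
  have "x \<in> circle" "y \<in> circle" "z \<in> circle" using V by (auto simp: generic_vertices_def)
  then have "sector x y = sector x z \<Longrightarrow> sector y z \<noteq> 1" using sector_eq_not_edge by blast
  then show ?thesis
    using C3_edge_iff[of V y z] C3_between_iff[of V y x z] sector_range[of x y] sector_range[of x z]
      comm assms by auto
qed

text \<open>This is the configuration that edge and betweenness cannot decide: if all pairs between \<open>{x, y}\<close>
  and \<open>{u, v}\<close> are adjacent, one of the two pairs could be flipped without violating either relation.
  With \<open>u\<close> and \<open>v\<close> in the middle sector of \<open>x\<close>, the cyclic order is \<open>x y u v\<close> or its reverse exactly
  when the two pairs have the same direction.\<close>

lemma separation_compares_opposite:
  assumes V: "generic_vertices V" "x \<in> V" "y \<in> V" "u \<in> V" "v \<in> V" "distinct [x, y, u, v]"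
    and ne: "sector x y \<noteq> 1" "sector u v \<noteq> 1" and opp: "sector x u = 1" "sector x v = 1"
  shows "sector x y = sector u v \<longleftrightarrow> C3_separation x y u v"
proof -
  have "x \<in> circle" "y \<in> circle" "u \<in> circle" "v \<in> circle" using V by (auto simp: generic_vertices_def)
  moreover have "sector v u = 2 - sector u v" using sector_commute V by auto
  ultimately show ?thesis
    using V ne opp sector_range[of x y] sector_range[of u v]
    by (auto simp: C3_separation_iff ccw_length_less_iff)
qed

text \<open>Edges are pairs with both sectors equal to 1, so only the non-adjacent pairs, called near in the
  proof, carry an orientation that \<open>f\<close> can keep or reverse. Two near pairs with a common vertex
  behave alike by \<open>between_detects_turning_back\<close>. Two other near pairs \<open>{x, y}\<close> and \<open>{u, v}\<close> are
  either linked by a near pair joining \<open>x\<close> to \<open>u\<close> or to \<open>v\<close>, or else \<open>x\<close> is adjacent to both \<open>u\<close> and \<open>v\<close> and separation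
  compares them by \<open>separation_compares_opposite\<close>.\<close>

lemma sector_preserved_or_reversed:
  assumes V: "generic_vertices V" and A: "A \<subseteq> V" and f: "f ` A \<subseteq> V" and inj: "inj_on f A"
    and E: "\<And>x y. x \<in> A \<Longrightarrow> y \<in> A \<Longrightarrow> C3_edge (f x) (f y) \<longleftrightarrow> C3_edge x y"
    and B: "\<And>x y z. x \<in> A \<Longrightarrow> y \<in> A \<Longrightarrow> z \<in> A \<Longrightarrow>
      C3_between (f x) (f y) (f z) \<longleftrightarrow> C3_between x y z"
    and S: "\<And>x y u v. x \<in> A \<Longrightarrow> y \<in> A \<Longrightarrow> u \<in> A \<Longrightarrow> v \<in> A \<Longrightarrow>
      C3_separation (f x) (f y) (f u) (f v) \<longleftrightarrow> C3_separation x y u v"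
  shows "(\<forall>x\<in>A. \<forall>y\<in>A. sector (f x) (f y) = sector x y) \<or>
         (\<forall>x\<in>A. \<forall>y\<in>A. sector (f x) (f y) = sector y x)"
proof -
  have mem: "x \<in> V" "f x \<in> V" if "x \<in> A" for x using that A f by auto
  have inj': "f x = f y \<longleftrightarrow> x = y" if "x \<in> A" "y \<in> A" for x y
    using inj that by (auto dest: inj_onD)
  define near where "near x y \<longleftrightarrow> x \<in> A \<and> y \<in> A \<and> x \<noteq> y \<and> sector x y \<noteq> 1" for x y
  define kept where "kept x y \<longleftrightarrow> sector (f x) (f y) = sector x y" for x y
  have E1: "sector (f x) (f y) = 1 \<longleftrightarrow> sector x y = 1" if "x \<in> A" "y \<in> A" for x y
    using E[OF that] C3_edge_iff[OF V, of x y] C3_edge_iff[OF V, of "f x" "f y"] mem that by blast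
  have comm: "sector y x = 2 - sector x y" "sector (f y) (f x) = 2 - sector (f x) (f y)"
    if "x \<in> A" "y \<in> A" "x \<noteq> y" for x y
    using sector_commute[OF V, of x y] sector_commute[OF V, of "f x" "f y"] mem inj' that by blast+
  have near_sym: "near y x" and kept_sym: "kept y x \<longleftrightarrow> kept x y" if "near x y" for x y
    using that comm[of x y] unfolding near_def kept_def by auto
  have range: "sector x y \<in> {0, 2}" "sector (f x) (f y) \<in> {0, 2}" if "near x y" for x y
    using that E1[of x y] sector_range[of x y] sector_range[of "f x" "f y"]
    unfolding near_def by auto
  have compare: "c = a \<longleftrightarrow> d = b"
    if "a \<in> {0, 2}" "b \<in> {0, 2}" "c \<in> {0, 2}" "d \<in> {0, 2}" "a = b \<longleftrightarrow> c = d" for a b c d :: int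
    using that by auto
  have two: "kept x y \<longleftrightarrow> kept x z" if "near x y" "near x z" for x y z
  proof (cases "y = z")
    case False
    have xyz: "x \<in> A" "y \<in> A" "z \<in> A" "x \<noteq> y" "x \<noteq> z" using that by (auto simp: near_def)
    have "sector x y = sector x z \<longleftrightarrow> \<not> C3_edge y z \<and> \<not> C3_between y x z"
      using between_detects_turning_back[OF V, of x y z] xyz mem False that by (auto simp: near_def)
    moreover have "sector (f x) (f y) = sector (f x) (f z) \<longleftrightarrow>
        \<not> C3_edge (f y) (f z) \<and> \<not> C3_between (f y) (f x) (f z)"
      using between_detects_turning_back[OF V, of "f x" "f y" "f z"] xyz mem inj' False that E1
      by (auto simp: near_def)
    ultimately show ?thesis
      unfolding kept_def using E[of y z] B[of y x z] xyz
      by - (rule compare[OF range(1)[OF that(1)] range(1)[OF that(2)] range(2)[OF that(1)] range(2)[OF that(2)]], blast)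
  qed simp
  have all: "kept x y \<longleftrightarrow> kept u v" if xy: "near x y" and uv: "near u v" for x y u v
  proof -
    consider "x = u" | "x = v" | "near x u" | "near x v" |
        "x \<noteq> u" "x \<noteq> v" "sector x u = 1" "sector x v = 1"
      using xy uv unfolding near_def by blast
    then show ?thesis
    proof cases
      case 1 then show ?thesis using two xy uv by blast
    next
      case 2 then show ?thesis using two xy uv near_sym kept_sym by blast
    next
      case 3 then show ?thesis using two[of x y u] two[of u x v] xy uv near_sym kept_sym by blast
    next
      case 4 then show ?thesis using two[of x y v] two[of v x u] xy uv near_sym kept_sym by blast
    next
      case 5
      have A': "x \<in> A" "y \<in> A" "u \<in> A" "v \<in> A" using xy uv by (auto simp: near_def)
      have d: "distinct [x, y, u, v]" using 5 xy uv by (auto simp: near_def)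
      have "sector x y = sector u v \<longleftrightarrow> C3_separation x y u v"
        using separation_compares_opposite[OF V, of x y u v] A' mem d 5 xy uv by (auto simp: near_def)
      moreover have "sector (f x) (f y) = sector (f u) (f v) \<longleftrightarrow> C3_separation (f x) (f y) (f u) (f v)"
        using separation_compares_opposite[OF V, of "f x" "f y" "f u" "f v"] A' mem inj' d 5 xy uv E1
        by (auto simp: near_def)
      ultimately show ?thesis
        unfolding kept_def using S[OF A']
        by - (rule compare[OF range(1)[OF xy] range(1)[OF uv] range(2)[OF xy] range(2)[OF uv]], blast)
    qed
  qed
  show ?thesis
  proof (cases "\<exists>x y. near x y \<and> kept x y")
    case True
    then have kept: "kept x y" if "near x y" for x y using all that by blast
    have "sector (f x) (f y) = sector x y" if "x \<in> A" "y \<in> A" for x y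
      using kept[of x y] E1[OF that] that unfolding near_def kept_def by (cases "x = y") auto
    then show ?thesis by blast
  next
    case False
    have "sector (f x) (f y) = sector y x" if xy: "x \<in> A" "y \<in> A" for x y
    proof (cases "near x y")
      case True
      then have "sector (f x) (f y) \<noteq> sector x y" "x \<noteq> y"
        using False unfolding kept_def near_def by blast+
      then show ?thesis using range[OF True] comm[OF xy] by auto
    next
      case False
      then show ?thesis using E1[OF xy] comm[OF xy] xy unfolding near_def by (cases "x = y") auto
    qed
    then show ?thesis by blast
  qed
qed

section \<open>Extension of sector-preserving maps\<close>

lemma dense_turn:
  assumes W: "generic_vertices W" and "0 < e"
  obtains s where "0 < s" "s < e" "turn (r + s) \<in> W"
proof -
  define p where "p = turn (r + e / 2)"
  have "isCont Arg 1" by (rule continuous_at_Arg) auto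
  moreover have "0 < pi / 3 * e" using assms by simp
  ultimately obtain d where d: "d > 0" "\<And>z. dist z 1 < d \<Longrightarrow> dist (Arg z) (Arg 1) < pi / 3 * e"
    unfolding continuous_at_eps_delta by metis
  have "p \<in> closure W" using W turn_in_circle unfolding generic_vertices_def p_def by blast
  then obtain w where w: "w \<in> W" "dist w p < d" using d(1) unfolding closure_approachable by blast
  have norm: "norm p = 1" "norm w = 1" using W w(1) by (auto simp: p_def generic_vertices_def)
  have "dist (w / p) 1 = norm ((w - p) / p)" using norm by (auto simp: dist_norm diff_divide_distrib)
  also have "\<dots> < d" using w(2) norm by (simp add: norm_divide dist_norm)
  finally have "\<bar>Arg (w / p)\<bar> < pi / 3 * e" using d(2) by (simp add: dist_real_def)
  define h where "h = Arg (w / p) / (2 * pi / 3)"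
  have "\<bar>h\<bar> < e / 2" using \<open>\<bar>Arg (w / p)\<bar> < pi / 3 * e\<close> by (simp add: h_def abs_divide field_simps)
  have "w / p = cis (Arg (w / p))" using norm by (subst cis_Arg) (auto simp: sgn_div_norm norm_divide)
  also have "\<dots> = turn h" by (simp add: turn_def h_def)
  finally have "w = p * turn h" by (simp add: p_def field_simps)
  also have "\<dots> = turn (r + (e / 2 + h))" by (simp add: p_def turn_def cis_mult distrib_left add.assoc)
  finally show ?thesis using that[of "e / 2 + h"] w(1) \<open>\<bar>h\<bar> < e / 2\<close> by (auto simp: abs_less_iff)
qed

text \<open>Rotate every \<open>fst q\<close> by a multiple of a third of the circumference so that the results lie in the
  third that ends at \<open>v\<close>. The sectors between the points \<open>fst q\<close> determine which rotated point comes
  last, and every arc of a third starting at a rotated point contains that last one. The same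
  rotations of the points \<open>snd q\<close> have the same property, so a vertex slightly beyond the last of
  them has the required sectors.\<close>

lemma one_point_extension:
  assumes V: "generic_vertices V" and W: "generic_vertices W"
    and p: "finite p" "p \<subseteq> V \<times> W"
    and pres: "\<And>q q'. q \<in> p \<Longrightarrow> q' \<in> p \<Longrightarrow> sector (fst q) (fst q') = sector (snd q) (snd q')"
    and v: "v \<in> V" "v \<notin> fst ` p"
  obtains w where "w \<in> W"
    "\<And>q. q \<in> p \<Longrightarrow> sector (fst q) v = sector (snd q) w \<and> sector v (fst q) = sector w (snd q)"
proof (cases "p = {}")
  case True
  then show ?thesis using dense_turn[OF W, of 1] that by (metis empty_iff zero_less_one)
next
  case False
  have VW: "fst q \<in> V" "snd q \<in> W" if "q \<in> p" for q using that p by auto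
  have circ: "fst q \<in> circle" "snd q \<in> circle" if "q \<in> p" for q
    using VW[OF that] V W by (auto simp: generic_vertices_def)
  obtain c where c: "v = turn c" using v V circle_turnE unfolding generic_vertices_def by (metis subsetD)
  have "\<exists>t. fst q = turn (c - t)" if "q \<in> p" for q
    using circle_turnE[OF circ(1)[OF that]] by (metis diff_diff_eq2 add_diff_cancel_left')
  then obtain t where t: "\<And>q. q \<in> p \<Longrightarrow> fst q = turn (c - t q)" by metis
  \<comment> \<open>Modulo a third of the circumference, \<open>fst q\<close> lies \<open>frac (t q)\<close> before \<open>v\<close>; the rotated point that
    comes last therefore belongs to the minimum.\<close>
  define F where "F = (\<lambda>q. frac (t q)) ` p"
  have "Min F \<in> F" using p False unfolding F_def by (intro Min_in) auto
  then obtain m where m: "m \<in> p" "frac (t m) = Min F" unfolding F_def by auto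
  have m_min: "frac (t m) \<le> frac (t q)" if "q \<in> p" for q
    unfolding m(2) using that p by (intro Min_le) (auto simp: F_def)
  obtain d where d: "snd m = turn d" using circle_turnE[OF circ(2)[OF m(1)]] by metis
  have "\<exists>s. snd q = turn (d - s)" if "q \<in> p" for q
    using circle_turnE[OF circ(2)[OF that]] by (metis diff_diff_eq2 add_diff_cancel_left')
  then obtain s where s: "\<And>q. q \<in> p \<Longrightarrow> snd q = turn (d - s q)" by metis
  have floor_s: "\<lfloor>s q\<rfloor> mod 3 = (\<lfloor>t q\<rfloor> - \<lfloor>t m\<rfloor>) mod 3" if "q \<in> p" for q
  proof -
    have "\<lfloor>t q - t m\<rfloor> = \<lfloor>t q\<rfloor> - \<lfloor>t m\<rfloor>"
      using m_min[OF that] frac_lt_1[of "t q"] frac_ge_0[of "t m"] unfolding frac_def by linarith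
    moreover have "sector (fst q) (fst m) = \<lfloor>t q - t m\<rfloor> mod 3"
      unfolding t[OF that] t[OF m(1)] sector_turn by simp
    moreover have "sector (snd q) (snd m) = \<lfloor>s q\<rfloor> mod 3"
      unfolding s[OF that] d sector_turn by simp
    ultimately show ?thesis using pres[OF that m(1)] by simp
  qed
  \<comment> \<open>Moving on by less than \<open>e\<close> from the last rotated point crosses no boundary of the
    sectors seen from the points \<open>snd q\<close>.\<close>
  define e where "e = Min ((\<lambda>q. 1 - frac (s q)) ` p)"
  have "0 < e" unfolding e_def using p False by (subst Min_gr_iff) (auto simp: frac_lt_1)
  have e_le: "e \<le> 1 - frac (s q)" if "q \<in> p" for q
    unfolding e_def using that p by (intro Min_le) auto
  obtain h where h: "0 < h" "h < e" "turn ((d + of_int \<lfloor>t m\<rfloor>) + h) \<in> W"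
    using dense_turn[OF W \<open>0 < e\<close>] by metis
  define w where "w = turn ((d + of_int \<lfloor>t m\<rfloor>) + h)"
  have "w \<in> W" using h by (simp add: w_def)
  show ?thesis
  proof (rule that[OF \<open>w \<in> W\<close>])
    fix q assume q: "q \<in> p"
    let ?r = "s q + of_int \<lfloor>t m\<rfloor> + h"
    have floor_r: "\<lfloor>?r\<rfloor> = \<lfloor>s q\<rfloor> + \<lfloor>t m\<rfloor>"
      using h(1,2) e_le[OF q] unfolding frac_def by linarith
    have "sector (snd q) w = \<lfloor>?r\<rfloor> mod 3"
      unfolding s[OF q] w_def sector_turn by (simp add: algebra_simps)
    also have "\<dots> = \<lfloor>t q\<rfloor> mod 3"
      unfolding floor_r using floor_s[OF q] by presburger
    also have "\<dots> = sector (fst q) v"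
      unfolding t[OF q] c sector_turn by simp
    finally have eq: "sector (snd q) w = sector (fst q) v" .
    have "fst q \<noteq> v" using q v by force
    moreover have "snd q \<noteq> w"
    proof
      assume "snd q = w"
      then have "((d + of_int \<lfloor>t m\<rfloor>) + h) - (d - s q) \<in> \<int>"
        unfolding s[OF q] w_def by (intro turn_eq_imp_Ints) simp
      then have "?r \<in> \<int>" by (simp add: algebra_simps)
      then have "?r = of_int \<lfloor>?r\<rfloor>" by (auto elim: Ints_cases)
      then have "?r - of_int \<lfloor>t m\<rfloor> = of_int \<lfloor>s q\<rfloor>" unfolding floor_r by simp
      then show False using h(1) of_int_floor_le[of "s q"] by linarith
    qed
    ultimately show "sector (fst q) v = sector (snd q) w \<and> sector v (fst q) = sector w (snd q)"
      using eq sector_commute[OF V VW(1)[OF q] v(1)] sector_commute[OF W VW(2)[OF q] \<open>w \<in> W\<close>] by simp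
  qed
qed

text \<open>A partial map is a set of pairs, and being a partial isomorphism is required to be a condition \<open>Q\<close>
  on two pairs at a time; it is therefore inherited by the union of a chain. The result is a set of
  pairs because \<open>Q\<close> alone does not make it the graph of a function.\<close>

lemma back_and_forth:
  fixes Q :: "'a \<times> 'b \<Rightarrow> 'a \<times> 'b \<Rightarrow> bool"
  defines "ok \<equiv> \<lambda>p. \<forall>x\<in>p. \<forall>y\<in>p. Q x y"
  assumes "countable V" "countable W" and p0: "finite p0" "p0 \<subseteq> V \<times> W" "ok p0"
    and extend_fst: "\<And>p v. finite p \<Longrightarrow> p \<subseteq> V \<times> W \<Longrightarrow> ok p \<Longrightarrow> v \<in> V \<Longrightarrow> v \<notin> fst ` p \<Longrightarrow>
      \<exists>w\<in>W. ok (insert (v, w) p)"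
    and extend_snd: "\<And>p w. finite p \<Longrightarrow> p \<subseteq> V \<times> W \<Longrightarrow> ok p \<Longrightarrow> w \<in> W \<Longrightarrow> w \<notin> snd ` p \<Longrightarrow>
      \<exists>v\<in>V. ok (insert (v, w) p)"
  obtains G where "p0 \<subseteq> G" "ok G" "fst ` G = V" "snd ` G = W"
proof -
  define good where "good p \<longleftrightarrow> finite p \<and> p \<subseteq> V \<times> W \<and> ok p" for p
  define covers where "covers n p \<longleftrightarrow>
      (from_nat_into V n \<in> V \<longrightarrow> from_nat_into V n \<in> fst ` p) \<and>
      (from_nat_into W n \<in> W \<longrightarrow> from_nat_into W n \<in> snd ` p)" for n p
  have F: "\<exists>q. good q \<and> p \<subseteq> q \<and> (v \<in> V \<longrightarrow> v \<in> fst ` q)" if "good p" for p v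
  proof (cases "v \<in> V \<and> v \<notin> fst ` p")
    case True
    then obtain w where "w \<in> W" "ok (insert (v, w) p)" using extend_fst \<open>good p\<close> unfolding good_def by blast
    then show ?thesis using True \<open>good p\<close> by (intro exI[of _ "insert (v, w) p"]) (auto simp: good_def)
  qed (use that in auto)
  have B: "\<exists>q. good q \<and> p \<subseteq> q \<and> (w \<in> W \<longrightarrow> w \<in> snd ` q)" if "good p" for p w
  proof (cases "w \<in> W \<and> w \<notin> snd ` p")
    case True
    then obtain v where "v \<in> V" "ok (insert (v, w) p)" using extend_snd \<open>good p\<close> unfolding good_def by blast
    then show ?thesis using True \<open>good p\<close> by (intro exI[of _ "insert (v, w) p"]) (auto simp: good_def)
  qed (use that in auto)
  have step: "\<exists>q. good q \<and> p \<subseteq> q \<and> covers n q" if p: "good p" for p n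
  proof -
    obtain q where q: "good q" "p \<subseteq> q" "from_nat_into V n \<in> V \<longrightarrow> from_nat_into V n \<in> fst ` q"
      using F[OF p] by metis
    obtain q' where "good q'" "q \<subseteq> q'" "from_nat_into W n \<in> W \<longrightarrow> from_nat_into W n \<in> snd ` q'"
      using B[OF q(1)] by metis
    then show ?thesis using q unfolding covers_def by (intro exI[of _ q']) blast
  qed
  have "\<exists>P. \<forall>n. (good (P n) \<and> p0 \<subseteq> P n) \<and> (P n \<subseteq> P (Suc n) \<and> covers n (P (Suc n)))"
  proof (rule dependent_nat_choice)
    show "\<exists>p. good p \<and> p0 \<subseteq> p" using p0 by (auto simp: good_def)
  next
    fix p n assume "good p \<and> p0 \<subseteq> p"
    then show "\<exists>q. (good q \<and> p0 \<subseteq> q) \<and> p \<subseteq> q \<and> covers n q" using step[of p n] by blast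
  qed
  then obtain P where P: "\<And>n. good (P n)" "\<And>n. p0 \<subseteq> P n" "\<And>n. P n \<subseteq> P (Suc n)"
    "\<And>n. covers n (P (Suc n))" by metis
  have mono: "P i \<subseteq> P j" if "i \<le> j" for i j using P(3) that by (rule lift_Suc_mono_le)
  define G where "G = (\<Union>n. P n)"
  have "G \<subseteq> V \<times> W" using P(1) unfolding G_def good_def by blast
  show ?thesis
  proof
    show "p0 \<subseteq> G" using P(2) unfolding G_def by blast
    show "ok G" unfolding ok_def
    proof (intro ballI)
      fix x y assume "x \<in> G" "y \<in> G"
      then obtain i j where "x \<in> P i" "y \<in> P j" unfolding G_def by blast
      then have "x \<in> P (max i j)" "y \<in> P (max i j)"
        using mono[of i "max i j"] mono[of j "max i j"] by auto
      then show "Q x y" using P(1)[of "max i j"] by (auto simp: good_def ok_def)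
    qed
    have "V \<subseteq> fst ` G"
    proof
      fix v assume "v \<in> V"
      then obtain n where "from_nat_into V n = v" using from_nat_into_surj \<open>countable V\<close> by metis
      then show "v \<in> fst ` G" using P(4)[of n] \<open>v \<in> V\<close> unfolding covers_def G_def by blast
    qed
    then show "fst ` G = V" using \<open>G \<subseteq> V \<times> W\<close> by auto
    have "W \<subseteq> snd ` G"
    proof
      fix w assume "w \<in> W"
      then obtain n where "from_nat_into W n = w" using from_nat_into_surj \<open>countable W\<close> by metis
      then show "w \<in> snd ` G" using P(4)[of n] \<open>w \<in> W\<close> unfolding covers_def G_def by blast
    qed
    then show "snd ` G = W" using \<open>G \<subseteq> V \<times> W\<close> by auto
  qed
qed

lemma sector_preserving_map_extends:
  assumes V: "generic_vertices V" and W: "generic_vertices W"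
    and A: "finite A" "A \<subseteq> V" and f: "f ` A \<subseteq> W"
    and pres: "\<And>x y. x \<in> A \<Longrightarrow> y \<in> A \<Longrightarrow> sector (f x) (f y) = sector x y"
  obtains g where "bij_betw g V W" "\<And>x. x \<in> A \<Longrightarrow> g x = f x"
    "\<And>x y. x \<in> V \<Longrightarrow> y \<in> V \<Longrightarrow> sector (g x) (g y) = sector x y"
proof -
  define Q where "Q q q' \<longleftrightarrow> sector (fst q) (fst q') = sector (snd q) (snd q')"
    for q q' :: "complex \<times> complex"
  obtain G where G: "(\<lambda>x. (x, f x)) ` A \<subseteq> G" "\<forall>q\<in>G. \<forall>q'\<in>G. Q q q'" "fst ` G = V" "snd ` G = W"
  proof (rule back_and_forth[of V W "(\<lambda>x. (x, f x)) ` A" Q])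
    show "countable V" "countable W" using V W by (auto simp: generic_vertices_def)
    show "finite ((\<lambda>x. (x, f x)) ` A)" "(\<lambda>x. (x, f x)) ` A \<subseteq> V \<times> W" using A f by auto
    show "\<forall>q\<in>(\<lambda>x. (x, f x)) ` A. \<forall>q'\<in>(\<lambda>x. (x, f x)) ` A. Q q q'" using pres by (auto simp: Q_def)
  next
    fix p v
    assume p: "finite p" "p \<subseteq> V \<times> W" "\<forall>q\<in>p. \<forall>q'\<in>p. Q q q'" and v: "v \<in> V" "v \<notin> fst ` p"
    obtain w where "w \<in> W"
      "\<And>q. q \<in> p \<Longrightarrow> sector (fst q) v = sector (snd q) w \<and> sector v (fst q) = sector w (snd q)"
      by (rule one_point_extension[OF V W p(1,2) _ v]) (use p(3) Q_def in auto)
    then show "\<exists>w\<in>W. \<forall>q\<in>insert (v, w) p. \<forall>q'\<in>insert (v, w) p. Q q q'"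
      using p(3) by (intro bexI[of _ w]) (auto simp: Q_def)
  next
    fix p w
    assume p: "finite p" "p \<subseteq> V \<times> W" "\<forall>q\<in>p. \<forall>q'\<in>p. Q q q'" and w: "w \<in> W" "w \<notin> snd ` p"
    let ?p = "prod.swap ` p"
    have p': "finite ?p" "?p \<subseteq> W \<times> V" "w \<notin> fst ` ?p" using p w by force+
    obtain v where v: "v \<in> V"
      "\<And>q. q \<in> ?p \<Longrightarrow> sector (fst q) w = sector (snd q) v \<and> sector w (fst q) = sector v (snd q)"
      by (rule one_point_extension[OF W V p'(1,2) _ w(1) p'(3)]) (use p(3) Q_def in force)+
    have "sector (snd q) w = sector (fst q) v \<and> sector w (snd q) = sector v (fst q)" if "q \<in> p" for q
      using v(2)[of "prod.swap q"] that by simp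
    then show "\<exists>v\<in>V. \<forall>q\<in>insert (v, w) p. \<forall>q'\<in>insert (v, w) p. Q q q'"
      using p(3) v(1) by (intro bexI[of _ v]) (auto simp: Q_def)
  qed
  have sub: "G \<subseteq> V \<times> W" using G(3,4) by (force simp: image_iff)
  have eq_iff: "x = x' \<longleftrightarrow> y = y'" if "(x, y) \<in> G" "(x', y') \<in> G" for x y x' y'
  proof -
    have "Q (x, y) (x', y')" "Q (x', y') (x, y)" using G(2) that by blast+
    then have e: "sector x x' = sector y y'" "sector x' x = sector y' y" by (simp_all add: Q_def)
    have "x \<in> V" "x' \<in> V" "y \<in> W" "y' \<in> W" using that sub by auto
    then show ?thesis using sector_eq_0_imp_eq[OF V] sector_eq_0_imp_eq[OF W] e by (metis sector_self)
  qed
  have "\<forall>x\<in>V. \<exists>y. (x, y) \<in> G" using G(3) by force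
  then obtain g where g: "\<And>x. x \<in> V \<Longrightarrow> (x, g x) \<in> G" by metis
  show ?thesis
  proof
    show "sector (g x) (g y) = sector x y" if "x \<in> V" "y \<in> V" for x y
      using G(2) g[OF that(1)] g[OF that(2)] by (force simp: Q_def)
    show "g x = f x" if "x \<in> A" for x
    proof -
      have "(x, f x) \<in> G" "(x, g x) \<in> G" using G(1) g A that by auto
      then show ?thesis using eq_iff by blast
    qed
    show "bij_betw g V W"
    proof (rule bij_betw_imageI)
      show "inj_on g V" using eq_iff g by (intro inj_onI) blast
      show "g ` V = W"
      proof
        show "g ` V \<subseteq> W" using g sub by blast
        show "W \<subseteq> g ` V"
        proof
          fix w assume "w \<in> W"
          then obtain v where "(v, w) \<in> G" using G(4) by force
          moreover then have "v \<in> V" using sub by blast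
          ultimately show "w \<in> g ` V" using g eq_iff by blast
        qed
      qed
    qed
  qed
qed

section \<open>Homogeneity\<close>

lemma isomorphism_C3_BS_iff:
  assumes "A \<subseteq> V" "A' \<subseteq> V"
  shows "isomorphism (induced_substructure (C3_BS V) A) (induced_substructure (C3_BS V) A') f \<longleftrightarrow>
    bij_betw f A A' \<and>
    (\<forall>x\<in>A. \<forall>y\<in>A. C3_edge (f x) (f y) \<longleftrightarrow> C3_edge x y) \<and>
    (\<forall>x\<in>A. \<forall>y\<in>A. \<forall>z\<in>A. C3_between (f x) (f y) (f z) \<longleftrightarrow> C3_between x y z) \<and>
    (\<forall>x\<in>A. \<forall>y\<in>A. \<forall>u\<in>A. \<forall>v\<in>A. C3_separation (f x) (f y) (f u) (f v) \<longleftrightarrow> C3_separation x y u v)"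
    (is "?iso \<longleftrightarrow> bij_betw f A A' \<and> ?E \<and> ?B \<and> ?S")
proof (cases "bij_betw f A A'")
  case True
  let ?R = "\<lambda>R xs. xs \<in> C3_relation V R \<longleftrightarrow> map f xs \<in> C3_relation V R"
  have mem: "x \<in> V" "f x \<in> V" if "x \<in> A" for x
    using that True assms by (auto simp: bij_betw_def)
  have all_symbols: "(\<forall>R. P R) \<longleftrightarrow> P Edge \<and> P Between \<and> P Separation" for P
    using C3_symbol.induct[of P] by blast
  have fA': "set (map f xs) \<subseteq> A'" if "set xs \<subseteq> A" for xs
    using that True by (auto simp: bij_betw_def)
  have "?iso \<longleftrightarrow> (\<forall>R xs. set xs \<subseteq> A \<longrightarrow> ?R R xs)"
    using True fA' by (simp add: isomorphism_def induced_substructure_def C3_BS_def)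
  also have "\<dots> \<longleftrightarrow> (\<forall>xs. set xs \<subseteq> A \<longrightarrow> ?R Edge xs) \<and> (\<forall>xs. set xs \<subseteq> A \<longrightarrow> ?R Between xs) \<and>
      (\<forall>xs. set xs \<subseteq> A \<longrightarrow> ?R Separation xs)"
    by (rule all_symbols)
  also have "(\<forall>xs. set xs \<subseteq> A \<longrightarrow> ?R Edge xs) \<longleftrightarrow> ?E"
  proof (rule iffI; intro ballI allI impI)
    fix x y assume L: "\<forall>xs. set xs \<subseteq> A \<longrightarrow> ?R Edge xs" and A: "x \<in> A" "y \<in> A"
    show "C3_edge (f x) (f y) \<longleftrightarrow> C3_edge x y"
      using L[rule_format, of "[x, y]"] A by (simp add: mem)
  next
    fix xs assume rel: ?E and xs: "set xs \<subseteq> A"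
    show "?R Edge xs"
    proof (cases "\<exists>x y. xs = [x, y]")
      case True then show ?thesis using rel xs mem by auto
    qed (auto simp: map_eq_Cons_conv)
  qed
  also have "(\<forall>xs. set xs \<subseteq> A \<longrightarrow> ?R Between xs) \<longleftrightarrow> ?B"
  proof (rule iffI; intro ballI allI impI)
    fix x y z assume L: "\<forall>xs. set xs \<subseteq> A \<longrightarrow> ?R Between xs" and A: "x \<in> A" "y \<in> A" "z \<in> A"
    show "C3_between (f x) (f y) (f z) \<longleftrightarrow> C3_between x y z"
      using L[rule_format, of "[x, y, z]"] A by (simp add: mem)
  next
    fix xs assume rel: ?B and xs: "set xs \<subseteq> A"
    show "?R Between xs"
    proof (cases "\<exists>x y z. xs = [x, y, z]")
      case True then show ?thesis using rel xs mem by auto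
    qed (auto simp: map_eq_Cons_conv)
  qed
  also have "(\<forall>xs. set xs \<subseteq> A \<longrightarrow> ?R Separation xs) \<longleftrightarrow> ?S"
  proof (rule iffI; intro ballI allI impI)
    fix x y u v assume L: "\<forall>xs. set xs \<subseteq> A \<longrightarrow> ?R Separation xs" and A: "x \<in> A" "y \<in> A" "u \<in> A" "v \<in> A"
    show "C3_separation (f x) (f y) (f u) (f v) \<longleftrightarrow> C3_separation x y u v"
      using L[rule_format, of "[x, y, u, v]"] A by (simp add: mem)
  next
    fix xs assume rel: ?S and xs: "set xs \<subseteq> A"
    show "?R Separation xs"
    proof (cases "\<exists>x y u v. xs = [x, y, u, v]")
      case True then show ?thesis using rel xs mem by auto
    qed (auto simp: map_eq_Cons_conv)
  qed
  finally show ?thesis using True by blast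
qed (auto simp: isomorphism_def induced_substructure_def)

theorem corollary41:
  fixes V :: "complex set"
  assumes "C3_vertex_set V"
  shows "homogeneous (C3_BS V)"
proof -
  note V = C3_vertex_set_generic[OF assms]
  have circ: "V \<subseteq> circle" using V by (simp add: generic_vertices_def)
  have self: "induced_substructure (C3_BS V) V = C3_BS V"
  proof -
    have "xs \<in> C3_relation V R \<Longrightarrow> set xs \<subseteq> V" for xs R by (cases R) auto
    then show ?thesis by (auto simp: induced_substructure_def C3_BS_def fun_eq_iff)
  qed
  show ?thesis unfolding homogeneous_def
  proof (intro allI impI, elim conjE)
    fix A A' f
    assume fin: "finite A" and A: "A \<subseteq> universe (C3_BS V)" and A': "A' \<subseteq> universe (C3_BS V)"
      and iso: "isomorphism (induced_substructure (C3_BS V) A) (induced_substructure (C3_BS V) A') f"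
    have AV: "A \<subseteq> V" "A' \<subseteq> V" using A A' by (simp_all add: C3_BS_def)
    note f = iso[unfolded isomorphism_C3_BS_iff[OF AV]]
    have fV: "f ` A \<subseteq> V" "inj_on f A" using f AV by (auto simp: bij_betw_def)
    consider (kept) "\<forall>x\<in>A. \<forall>y\<in>A. sector (f x) (f y) = sector x y"
      | (reversed) "\<forall>x\<in>A. \<forall>y\<in>A. sector (f x) (f y) = sector y x"
      using sector_preserved_or_reversed[OF V AV(1) fV] f by blast
    \<comment> \<open>In the reversed case \<open>cnj \<circ> f\<close> keeps the sectors; its extension onto the reflected vertex set is
      reflected back.\<close>
    then obtain g where g: "bij_betw g V V" "\<forall>x\<in>A. g x = f x"
      "\<forall>x\<in>V. \<forall>y\<in>V. C3_edge (g x) (g y) \<longleftrightarrow> C3_edge x y"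
      "\<forall>x\<in>V. \<forall>y\<in>V. \<forall>z\<in>V. C3_between (g x) (g y) (g z) \<longleftrightarrow> C3_between x y z"
      "\<forall>x\<in>V. \<forall>y\<in>V. \<forall>u\<in>V. \<forall>v\<in>V. C3_separation (g x) (g y) (g u) (g v) \<longleftrightarrow> C3_separation x y u v"
    proof cases
      case kept
      then obtain g where "bij_betw g V V" "\<And>x. x \<in> A \<Longrightarrow> g x = f x"
        "\<And>x y. x \<in> V \<Longrightarrow> y \<in> V \<Longrightarrow> sector (g x) (g y) = sector x y"
        using sector_preserving_map_extends[OF V V fin AV(1) fV(1)] by metis
      then show ?thesis using that sector_preserving_relations[OF V V] by blast
    next
      case reversed
      define W where "W = cnj ` V"
      have W: "generic_vertices W" unfolding W_def by (rule generic_vertices_cnj[OF V])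
      have "(cnj \<circ> f) ` A \<subseteq> W" using fV by (auto simp: W_def)
      moreover have "sector ((cnj \<circ> f) x) ((cnj \<circ> f) y) = sector x y" if "x \<in> A" "y \<in> A" for x y
      proof -
        have "f x \<in> circle" "f y \<in> circle" using that fV(1) circ by blast+
        then show ?thesis using reversed that by (simp add: sector_cnj del: mem_sphere)
      qed
      ultimately obtain h where h: "bij_betw h V W" "\<And>x. x \<in> A \<Longrightarrow> h x = (cnj \<circ> f) x"
        "\<And>x y. x \<in> V \<Longrightarrow> y \<in> V \<Longrightarrow> sector (h x) (h y) = sector x y"
        by (rule sector_preserving_map_extends[OF V W fin AV(1)]) blast+
      have hW: "h x \<in> W" "h x \<in> circle" if "x \<in> V" for x
        using h(1) that W by (auto simp: bij_betw_def generic_vertices_def)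
      have "bij_betw cnj W V" by (rule bij_betwI[of _ _ _ cnj]) (auto simp: W_def)
      then have "bij_betw (cnj \<circ> h) V V" using h(1) by (rule bij_betw_trans[rotated])
      then show ?thesis
        using that[of "cnj \<circ> h"] h(2) hW sector_preserving_relations[OF V W h(1,3)]
          cnj_relations(1) cnj_relations(2)[OF W] cnj_relations(3)
        by simp
    qed
    have "isomorphism (C3_BS V) (C3_BS V) g"
      using isomorphism_C3_BS_iff[of V V V g] g unfolding self by blast
    then show "\<exists>g. isomorphism (C3_BS V) (C3_BS V) g \<and> (\<forall>x\<in>A. g x = f x)" using g(2) by blast
  qed
qed

end
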